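(* Let $n\ge1$ and let $X$ be a $(\mathbb{Z}/n\mathbb{Z})$-circulant, i.e. a graph of order $n$ whose Hermitian adjacency matrix $A\in\mathbb{C}^{n\times n}$ is a circulant matrix. If the eigenvalues of $A$ are all distinct ($A$ has $n$ distinct eigenvalues), then $X$ has average uniform mixing, that is, $\widehat{M}_X=\frac1nJ_n$.
   Context: A matrix $A$ indexed by $\mathbb{Z}/n\mathbb{Z}$ is circulant if $A_{j,k}$ depends only on $k-j$ modulo $n$. Complex edge weights are allowed as long as $A$ is Hermitian. For a graph $X$ of order $n$ with Hermitian adjacency matrix $A$, let $U_X(t)=e^{-itA}$ and $M_X(t)=U_X(t)\circ\overline{U_X(t)}$ (entrywise product). The average mixing matrix is $\widehat{M}_X=\lim_{T\to\infty}\frac1T\int_0^TM_X(t)\,dt$. $J_n$ is the $n\times n$ all-one matrix. *)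

theory Defs
  imports "HOL-Analysis.Analysis" "Jordan_Normal_Form.Spectral_Radius"
begin

text \<open>Rows and columns are indexed by the representatives \<open>0, \<dots>, n - 1\<close> of the integers
  modulo \<open>n\<close>; differences are taken in \<^typ>\<open>int\<close> to avoid truncated subtraction.\<close>

definition circulant_mat :: "nat \<Rightarrow> 'a mat \<Rightarrow> bool" where
  "circulant_mat n A \<longleftrightarrow> A \<in> carrier_mat n n \<and>
     (\<forall>j<n. \<forall>k<n. \<forall>j'<n. \<forall>k'<n.
        (int k - int j) mod int n = (int k' - int j') mod int n \<longrightarrow> A $$ (j, k) = A $$ (j', k'))"

definition hermitian_mat :: "complex mat \<Rightarrow> bool" where
  "hermitian_mat A \<longleftrightarrow> square_mat A \<and> mat_adjoint A = A"

definition hadamard_prod :: "'a::times mat \<Rightarrow> 'a mat \<Rightarrow> 'a mat" where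
  "hadamard_prod A B = mat (dim_row A) (dim_col A) (\<lambda>(j, k). A $$ (j, k) * B $$ (j, k))"

definition all_ones_mat :: "nat \<Rightarrow> 'a::one mat" where
  "all_ones_mat n = mat n n (\<lambda>_. 1)"

text \<open>The exponential power series, summed entrywise. The type of matrices has no topology, and
  all norms on the space of matrices of a fixed size are equivalent, so this is the usual matrix
  exponential. The series always converges, see \<open>summable_mat_exp\<close> below.\<close>

definition mat_exp :: "complex mat \<Rightarrow> complex mat" where
  "mat_exp A = mat (dim_row A) (dim_row A) (\<lambda>(j, k). \<Sum>m. (A ^\<^sub>m m) $$ (j, k) / fact m)"

definition transition_mat :: "complex mat \<Rightarrow> real \<Rightarrow> complex mat" where
  "transition_mat A t = mat_exp ((- \<i> * complex_of_real t) \<cdot>\<^sub>m A)"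

definition mixing_mat :: "complex mat \<Rightarrow> real \<Rightarrow> complex mat" where
  "mixing_mat A t = hadamard_prod (transition_mat A t) (map_mat cnj (transition_mat A t))"

text \<open>\<open>L\<close> is the average mixing matrix of \<open>A\<close>: the time averages of the mixing matrix converge
  to it. Integral and limit of matrices are entrywise.\<close>

definition has_average_mixing_mat :: "complex mat \<Rightarrow> complex mat \<Rightarrow> bool" where
  "has_average_mixing_mat A L \<longleftrightarrow> L \<in> carrier_mat (dim_row A) (dim_row A) \<and>
     (\<forall>j<dim_row A. \<forall>k<dim_row A.
        ((\<lambda>T::real. (1 / T) *\<^sub>R integral {0..T} (\<lambda>t. mixing_mat A t $$ (j, k)))
           \<longlongrightarrow> L $$ (j, k)) at_top)"

definition average_uniform_mixing :: "complex mat \<Rightarrow> bool" where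
  "average_uniform_mixing A \<longleftrightarrow>
     has_average_mixing_mat A ((1 / of_nat (dim_row A)) \<cdot>\<^sub>m all_ones_mat (dim_row A))"

lemma hermitian_mat_iff:
  assumes "A \<in> carrier_mat n n"
  shows "hermitian_mat A \<longleftrightarrow> (\<forall>j<n. \<forall>k<n. A $$ (j, k) = cnj (A $$ (k, j)))"
proof -
  have ent: "mat_adjoint A $$ (j, k) = cnj (A $$ (k, j))" if "j < n" "k < n" for j k
    using assms that by (simp add: mat_adjoint_def mat_of_rows_def)
  have dims: "dim_row (mat_adjoint A) = n" "dim_col (mat_adjoint A) = n"
    using assms by (simp_all add: mat_adjoint_def)
  have "mat_adjoint A = A \<longleftrightarrow> (\<forall>j<n. \<forall>k<n. mat_adjoint A $$ (j, k) = A $$ (j, k))"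
    using assms unfolding mat_eq_iff dims by auto
  also have "\<dots> \<longleftrightarrow> (\<forall>j<n. \<forall>k<n. A $$ (j, k) = cnj (A $$ (k, j)))"
    by (metis ent)
  finally show ?thesis
    using assms unfolding hermitian_mat_def by (simp only: square_mat.simps carrier_matD simp_thms)
qed

lemma summable_mat_exp:
  fixes A :: "complex mat"
  assumes A: "A \<in> carrier_mat n n" and jk: "j < n" "k < n"
  shows "summable (\<lambda>m. (A ^\<^sub>m m) $$ (j, k) / fact m)"
proof -
  define b where "b = (\<Sum>p\<in>{..<n} \<times> {..<n}. norm (A $$ p))"
  have b0: "b \<ge> 0" by (simp add: b_def sum_nonneg)
  have ent: "norm (A $$ (i, l)) \<le> b" if "i < n" "l < n" for i l
    unfolding b_def by (rule member_le_sum) (use that in auto)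
  have bnd: "\<forall>i<n. \<forall>l<n. norm ((A ^\<^sub>m m) $$ (i, l)) \<le> (real n * b) ^ m" for m
  proof (induction m)
    case 0
    then show ?case using A by simp
  next
    case (Suc m)
    show ?case
    proof (intro allI impI)
      fix i l assume il: "i < n" "l < n"
      have "(A ^\<^sub>m Suc m) $$ (i, l) = (\<Sum>r<n. (A ^\<^sub>m m) $$ (i, r) * A $$ (r, l))"
        using A il by (simp add: scalar_prod_def atLeast0LessThan)
      also have "norm \<dots> \<le> (\<Sum>r<n. (real n * b) ^ m * b)"
        by (rule sum_norm_le)
           (use Suc.IH ent il b0 in \<open>auto simp: norm_mult intro!: mult_mono\<close>)
      also have "\<dots> = (real n * b) ^ Suc m" by simp
      finally show "norm ((A ^\<^sub>m Suc m) $$ (i, l)) \<le> (real n * b) ^ Suc m" .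
    qed
  qed
  have "norm ((A ^\<^sub>m m) $$ (j, k) / fact m) \<le> (real n * b) ^ m /\<^sub>R fact m" for m
  proof -
    have "norm ((A ^\<^sub>m m) $$ (j, k)) \<le> (real n * b) ^ m"
      using bnd[of m] jk by blast
    then have "norm ((A ^\<^sub>m m) $$ (j, k)) / fact m \<le> (real n * b) ^ m / fact m"
      by (rule divide_right_mono) simp
    then show ?thesis
      unfolding norm_mult norm_inverse norm_fact real_scaleR_def divide_inverse by (simp only: mult.commute)
  qed
  then have "\<exists>N. \<forall>m\<ge>N. norm ((A ^\<^sub>m m) $$ (j, k) / fact m) \<le> (real n * b) ^ m /\<^sub>R fact m"
    by blast
  then show ?thesis
    by (rule summable_comparison_test[OF _ summable_exp_generic])
qed

end

theory Submission
  imports Defs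
begin

text \<open>The characters \<open>k \<mapsto> \<zeta>\<^sup>r\<^sup>k\<close> of the cyclic group diagonalize every circulant matrix, so every
  entry \<open>(j, k)\<close> of the mixing matrix is \<open>1 / n\<^sup>2\<close> times the sum over \<open>r\<close> and \<open>s\<close> of
  \<open>exp (- \<i> t (\<lambda>\<^sub>r - \<lambda>\<^sub>s))\<close> with coefficients of modulus \<open>1\<close>, equal to \<open>1\<close> on the diagonal. If the
  eigenvalues are distinct, averaging over time kills all terms with \<open>r \<noteq> s\<close>, and the \<open>n\<close> diagonal
  terms leave \<open>1 / n\<close>.\<close>

section \<open>Roots of unity and discrete Fourier inversion\<close>

definition zeta :: "nat \<Rightarrow> complex" where
  "zeta n = exp (2 * of_real pi * \<i> / of_nat n)"

lemma zeta_power: "zeta n ^ j = exp (2 * of_real pi * \<i> * of_nat j / of_nat n)"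
  by (simp add: zeta_def mult_ac flip: exp_of_nat_mult)

lemma zeta_power_self [simp]: "n \<ge> 1 \<Longrightarrow> zeta n ^ n = 1"
  by (simp add: zeta_power exp_two_pi_i)

text \<open>Characters depend only on the residue of \<open>m\<close>; this permits reindexing sums
  by cyclic shifts.\<close>

lemma zeta_power_mod: "n \<ge> 1 \<Longrightarrow> zeta n ^ (r * (m mod n)) = zeta n ^ (r * m)"
proof -
  assume n: "n \<ge> 1"
  have "zeta n ^ (r * m) = zeta n ^ (r * (n * (m div n) + m mod n))" by simp
  also have "\<dots> = (zeta n ^ n) ^ (r * (m div n)) * zeta n ^ (r * (m mod n))"
    by (simp only: distrib_left power_add mult_ac flip: power_mult)
  finally show ?thesis using n by simp
qed

lemma zeta_power_inj:
  assumes "j < n" "k < n" "zeta n ^ j = zeta n ^ k"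
  shows "j = k"
  using assms complex_root_unity_eq[of n j k] by (simp add: zeta_power cong_def)

lemma norm_zeta [simp]: "norm (zeta n) = 1"
proof -
  have "zeta n = exp (\<i> * of_real (2 * pi / of_nat n))" by (simp add: zeta_def mult_ac)
  then show ?thesis by (simp only: norm_exp_i_times)
qed

lemma zeta_power_mult_cnj: "zeta n ^ m * cnj (zeta n ^ m) = 1"
  using complex_norm_square[of "zeta n ^ m"] by (simp add: norm_power)

text \<open>The sum is geometric with ratio \<open>z\<close>, an \<open>n\<close>-th root of unity
  that equals 1 only for \<open>j = k\<close>.\<close>

lemma zeta_orthogonal:
  assumes jk: "j < n" "k < n"
  shows "(\<Sum>r<n. zeta n ^ (r * j) * cnj (zeta n ^ (r * k))) = (if j = k then of_nat n else 0)"
proof -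
  define z where "z = zeta n ^ j * cnj (zeta n ^ k)"
  have sum_z: "(\<Sum>r<n. zeta n ^ (r * j) * cnj (zeta n ^ (r * k))) = (\<Sum>r<n. z ^ r)"
    unfolding z_def by (simp add: power_mult_distrib mult.commute flip: power_mult)
  show ?thesis
  proof (cases "j = k")
    case True
    then have "z = 1" unfolding z_def by (simp only: zeta_power_mult_cnj)
    then show ?thesis using True sum_z by simp
  next
    case False
    have "z \<noteq> 1"
    proof
      assume "z = 1"
      \<comment> \<open>On the unit circle the conjugate is the inverse, so \<open>z\<close> is the
        quotient of the two powers and \<open>z = 1\<close> would make them equal.\<close>
      then have "zeta n ^ k = z * zeta n ^ k" by simp
      also have "\<dots> = zeta n ^ j * (zeta n ^ k * cnj (zeta n ^ k))"
        by (simp add: z_def)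
      also have "\<dots> = zeta n ^ j" by (simp only: zeta_power_mult_cnj mult_1_right)
      finally show False using zeta_power_inj[of k n j] jk False by simp
    qed
    moreover have "z ^ n = (zeta n ^ n) ^ j * cnj ((zeta n ^ n) ^ k)"
      unfolding z_def by (simp add: power_mult_distrib mult.commute flip: power_mult)
    then have "z ^ n = 1" using jk by simp
    ultimately show ?thesis using False sum_z by (simp add: geometric_sum)
  qed
qed

text \<open>Orthogonality turns the inner sum into \<open>n\<close> times a Kronecker delta. The
  function \<open>f\<close> will be a row of a matrix, a conjugated eigenvector, or a family of
  rescaled Fourier coefficients.\<close>

lemma fourier_inversion:
  assumes "k < n"
  shows "(\<Sum>l<n. f l * (\<Sum>r<n. zeta n ^ (r * l) * cnj (zeta n ^ (r * k)))) = of_nat n * f k"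
proof -
  have "(\<Sum>l<n. f l * (\<Sum>r<n. zeta n ^ (r * l) * cnj (zeta n ^ (r * k)))) =
      (\<Sum>l<n. if l = k then of_nat n * f l else 0)"
    using assms by (intro sum.cong refl) (simp add: zeta_orthogonal del: complex_cnj_power)
  then show ?thesis using assms by simp
qed

section \<open>Circulant matrices in the character basis: eigenvalues, powers, exponential\<close>

text \<open>Row \<open>j\<close> is row 0 shifted cyclically by \<open>j\<close>. Substituting
  \<open>k = (j + d) mod n\<close> therefore pulls out the factor \<open>zeta n ^ (r * j)\<close>,
  and the eigenvalue is the Fourier transform of row 0.\<close>

lemma circulant_mat_eigen:
  assumes n: "n \<ge> 1" and C: "circulant_mat n A" and j: "j < n"
  shows "(\<Sum>k<n. A $$ (j, k) * zeta n ^ (r * k)) =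
    (\<Sum>d<n. A $$ (0, d) * zeta n ^ (r * d)) * zeta n ^ (r * j)"
proof -
  have bij: "bij_betw (\<lambda>d. (j + d) mod n) {..<n} {..<n}"
  \<comment> \<open>The inverse shift adds \<open>n - j\<close>, since subtracting \<open>j\<close>
    would truncate on natural numbers.\<close>
  proof (rule bij_betw_byWitness[where f' = "\<lambda>k. (k + (n - j)) mod n"])
    show "\<forall>d\<in>{..<n}. ((j + d) mod n + (n - j)) mod n = d"
    proof
      fix d assume "d \<in> {..<n}"
      have "((j + d) mod n + (n - j)) mod n = (j + d + (n - j)) mod n"
        by (rule mod_add_left_eq)
      also have "j + d + (n - j) = d + n" using j by simp
      finally have "((j + d) mod n + (n - j)) mod n = (d + n) mod n" .
      then show "((j + d) mod n + (n - j)) mod n = d" using \<open>d \<in> {..<n}\<close> by simp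
    qed
    show "\<forall>k\<in>{..<n}. (j + (k + (n - j)) mod n) mod n = k"
    proof
      fix k assume "k \<in> {..<n}"
      have "(j + (k + (n - j)) mod n) mod n = (j + (k + (n - j))) mod n"
        by (rule mod_add_right_eq)
      also have "j + (k + (n - j)) = k + n" using j by simp
      finally have "(j + (k + (n - j)) mod n) mod n = (k + n) mod n" .
      then show "(j + (k + (n - j)) mod n) mod n = k" using \<open>k \<in> {..<n}\<close> by simp
    qed
  qed (use n in auto)
  have shift: "A $$ (j, (j + d) mod n) = A $$ (0, d)" if "d < n" for d
  proof -
    have "(int ((j + d) mod n) - int j) mod int n = (int d - int 0) mod int n"
      by (simp add: zmod_int mod_diff_left_eq)
    then show ?thesis using C j that n unfolding circulant_mat_def by fastforce
  qed
  have "(\<Sum>k<n. A $$ (j, k) * zeta n ^ (r * k)) =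
      (\<Sum>d<n. A $$ (j, (j + d) mod n) * zeta n ^ (r * ((j + d) mod n)))"
    by (rule sum.reindex_bij_betw[OF bij, symmetric])
  also have "\<dots> = (\<Sum>d<n. A $$ (0, d) * zeta n ^ (r * d) * zeta n ^ (r * j))"
    using n by (intro sum.cong refl) (simp add: shift zeta_power_mod distrib_left power_add)
  finally show ?thesis by (simp add: sum_distrib_right)
qed

lemma fourier_diagonal_pow:
  fixes B :: "complex mat"
  assumes B: "B \<in> carrier_mat n n"
    and ev: "\<And>r j. j < n \<Longrightarrow> (\<Sum>k<n. B $$ (j, k) * zeta n ^ (r * k)) = \<mu> r * zeta n ^ (r * j)"
    and j: "j < n"
  shows "(\<Sum>k<n. (B ^\<^sub>m m) $$ (j, k) * zeta n ^ (r * k)) = \<mu> r ^ m * zeta n ^ (r * j)"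
  using j
proof (induction m)
  case 0
  have "(\<Sum>k<n. (B ^\<^sub>m 0) $$ (j, k) * zeta n ^ (r * k)) =
      (\<Sum>k<n. if k = j then zeta n ^ (r * k) else 0)"
    using B 0 by (intro sum.cong refl) auto
  then show ?case using 0 by simp
next
  case (Suc m)
  have "(\<Sum>k<n. (B ^\<^sub>m Suc m) $$ (j, k) * zeta n ^ (r * k)) =
      (\<Sum>k<n. \<Sum>l<n. (B ^\<^sub>m m) $$ (j, l) * B $$ (l, k) * zeta n ^ (r * k))"
    using B Suc.prems
    by (intro sum.cong refl) (simp add: scalar_prod_def atLeast0LessThan sum_distrib_right)
  \<comment> \<open>The last factor \<open>B\<close> of the power acts on the character first, so
    \<open>ev\<close> applies before the induction hypothesis.\<close>
  also have "\<dots> = (\<Sum>l<n. (B ^\<^sub>m m) $$ (j, l) * (\<Sum>k<n. B $$ (l, k) * zeta n ^ (r * k)))"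
    by (subst sum.swap) (simp add: sum_distrib_left mult.assoc)
  also have "\<dots> = (\<Sum>l<n. (B ^\<^sub>m m) $$ (j, l) * zeta n ^ (r * l)) * \<mu> r"
    unfolding sum_distrib_right by (intro sum.cong refl) (subst ev, simp_all)
  finally show ?case using Suc by simp
qed

text \<open>The hypothesis gives the Fourier transform of row \<open>j\<close>; inverting it yields
  the spectral decomposition of \<open>B\<close>, entry by entry.\<close>

lemma fourier_diagonal_entry:
  fixes B :: "complex mat"
  assumes ev: "\<And>r. (\<Sum>k<n. B $$ (j, k) * zeta n ^ (r * k)) = \<mu> r * zeta n ^ (r * j)"
    and k: "k < n"
  shows "B $$ (j, k) = (\<Sum>r<n. \<mu> r * (zeta n ^ (r * j) * cnj (zeta n ^ (r * k)))) / of_nat n"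
proof -
  have "of_nat n * B $$ (j, k) =
      (\<Sum>l<n. B $$ (j, l) * (\<Sum>r<n. zeta n ^ (r * l) * cnj (zeta n ^ (r * k))))"
    by (rule fourier_inversion[OF k, symmetric])
  also have "\<dots> = (\<Sum>r<n. (\<Sum>l<n. B $$ (j, l) * zeta n ^ (r * l)) * cnj (zeta n ^ (r * k)))"
    unfolding sum_distrib_left sum_distrib_right by (subst sum.swap) (simp only: mult.assoc)
  also have "\<dots> = (\<Sum>r<n. \<mu> r * (zeta n ^ (r * j) * cnj (zeta n ^ (r * k))))"
    by (simp only: ev mult.assoc)
  finally show ?thesis using k by (simp add: field_simps)
qed

text \<open>Each power of \<open>B\<close> has the same eigenvectors, so its entries are finite
  combinations of the \<open>\<mu> r ^ m\<close>, and the exponential series can be summed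
  separately for each \<open>r\<close>.\<close>

lemma fourier_diagonal_mat_exp:
  fixes B :: "complex mat"
  assumes B: "B \<in> carrier_mat n n"
    and ev: "\<And>r j. j < n \<Longrightarrow> (\<Sum>k<n. B $$ (j, k) * zeta n ^ (r * k)) = \<mu> r * zeta n ^ (r * j)"
    and jk: "j < n" "k < n"
  shows "mat_exp B $$ (j, k) =
    (\<Sum>r<n. exp (\<mu> r) * (zeta n ^ (r * j) * cnj (zeta n ^ (r * k)))) / of_nat n"
proof -
  let ?c = "\<lambda>r. zeta n ^ (r * j) * cnj (zeta n ^ (r * k))"
  have "(\<lambda>m. \<mu> r ^ m / fact m) sums exp (\<mu> r)" for r
    using exp_converges[of "\<mu> r"] by (simp add: scaleR_conv_of_real field_simps)
  then have "(\<lambda>m. (\<Sum>r<n. \<mu> r ^ m / fact m * ?c r) / of_nat n) sums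
      ((\<Sum>r<n. exp (\<mu> r) * ?c r) / of_nat n)"
    by (intro sums_divide sums_sum sums_mult2)
  moreover have "(\<Sum>r<n. \<mu> r ^ m / fact m * ?c r) / of_nat n = (B ^\<^sub>m m) $$ (j, k) / fact m" for m
  proof -
    have "(B ^\<^sub>m m) $$ (j, k) = (\<Sum>r<n. \<mu> r ^ m * ?c r) / of_nat n"
      by (rule fourier_diagonal_entry[OF _ jk(2)]) (rule fourier_diagonal_pow[OF B ev jk(1)])
    then show ?thesis by (simp add: sum_divide_distrib mult_ac)
  qed
  ultimately have "(\<Sum>m. (B ^\<^sub>m m) $$ (j, k) / fact m) = (\<Sum>r<n. exp (\<mu> r) * ?c r) / of_nat n"
    by (simp add: sums_iff)
  then show ?thesis using B jk by (simp add: mat_exp_def)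
qed

section \<open>Completeness and reality of the eigenvalues\<close>

text \<open>Expand an eigenvector for \<open>x\<close> in characters: each coefficient is killed by
  \<open>\<mu> r - x\<close>, so some \<open>\<mu> r\<close> equals \<open>x\<close>, as otherwise
  the vector vanishes. Together with a cardinality count, this inclusion makes the
  \<open>\<mu> r\<close> distinct.\<close>

lemma spectrum_fourier_diagonal:
  fixes A :: "complex mat"
  assumes A: "A \<in> carrier_mat n n"
    and ev: "\<And>r j. j < n \<Longrightarrow> (\<Sum>k<n. A $$ (j, k) * zeta n ^ (r * k)) = \<mu> r * zeta n ^ (r * j)"
  shows "spectrum A \<subseteq> \<mu> ` {..<n}"
proof
  fix x assume "x \<in> spectrum A"
  then obtain v where v: "v \<in> carrier_vec n" "v \<noteq> 0\<^sub>v n" and Av: "A *\<^sub>v v = x \<cdot>\<^sub>v v"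
    using A by (auto simp: spectrum_def eigenvalue_def eigenvector_def)
  define w where "w r = (\<Sum>k<n. cnj (zeta n ^ (r * k)) * v $ k)" for r
  have Avj: "(\<Sum>k<n. A $$ (j, k) * v $ k) = x * v $ j" if "j < n" for j
    using arg_cong[OF Av, of "\<lambda>u. u $ j"] A v that
    by (simp add: scalar_prod_def atLeast0LessThan)
  have inv: "of_nat n * v $ k = (\<Sum>r<n. zeta n ^ (r * k) * w r)" if "k < n" for k
  proof -
    \<comment> \<open>Conjugating twice moves the conjugation to the factor where
      \<open>fourier_inversion\<close> expects it.\<close>
    have "of_nat n * v $ k = cnj (of_nat n * cnj (v $ k))" by simp
    also have "\<dots> = cnj (\<Sum>l<n. cnj (v $ l) * (\<Sum>r<n. zeta n ^ (r * l) * cnj (zeta n ^ (r * k))))"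
      by (simp only: fourier_inversion[OF that])
    also have "\<dots> = (\<Sum>l<n. \<Sum>r<n. zeta n ^ (r * k) * (cnj (zeta n ^ (r * l)) * v $ l))"
      by (simp add: sum_distrib_left mult_ac)
    also have "\<dots> = (\<Sum>r<n. zeta n ^ (r * k) * w r)"
      unfolding w_def sum_distrib_left by (rule sum.swap)
    finally show ?thesis .
  qed
  have eq: "(\<Sum>r<n. zeta n ^ (r * j) * ((\<mu> r - x) * w r)) = 0" if j: "j < n" for j
  proof -
    have "(\<Sum>r<n. zeta n ^ (r * j) * (\<mu> r * w r)) =
        (\<Sum>r<n. (\<Sum>k<n. A $$ (j, k) * zeta n ^ (r * k)) * w r)"
      using j by (simp add: ev mult_ac)
    also have "\<dots> = (\<Sum>k<n. A $$ (j, k) * (\<Sum>r<n. zeta n ^ (r * k) * w r))"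
      unfolding sum_distrib_left sum_distrib_right by (subst sum.swap) (simp only: mult.assoc)
    also have "\<dots> = (\<Sum>k<n. of_nat n * (A $$ (j, k) * v $ k))"
      by (intro sum.cong refl) (simp add: inv[symmetric])
    also have "\<dots> = of_nat n * (x * v $ j)"
      using j by (simp add: Avj flip: sum_distrib_left)
    also have "\<dots> = (\<Sum>r<n. zeta n ^ (r * j) * (x * w r))"
      using inv[OF j] by (simp add: mult.left_commute flip: sum_distrib_left)
    finally show ?thesis by (simp add: algebra_simps sum_subtractf)
  qed
  have zero: "(\<mu> r - x) * w r = 0" if r: "r < n" for r
  proof -
    \<comment> \<open>A second inversion, now summing over positions \<open>j\<close>, isolates the
      coefficient with index \<open>r\<close> from the relations \<open>eq\<close>.\<close>
    have "of_nat n * ((\<mu> r - x) * w r) =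
        (\<Sum>s<n. (\<mu> s - x) * w s * (\<Sum>j<n. zeta n ^ (j * s) * cnj (zeta n ^ (j * r))))"
      by (rule fourier_inversion[OF r, symmetric])
    also have "\<dots> = (\<Sum>j<n. (\<Sum>s<n. zeta n ^ (s * j) * ((\<mu> s - x) * w s)) * cnj (zeta n ^ (j * r)))"
      unfolding sum_distrib_left sum_distrib_right
      by (subst sum.swap) (simp only: mult_ac)
    also have "\<dots> = 0" by (simp add: eq)
    finally show ?thesis using r by simp
  qed
  show "x \<in> \<mu> ` {..<n}"
  proof (rule ccontr)
    assume "x \<notin> \<mu> ` {..<n}"
    then have "w r = 0" if "r < n" for r using zero[OF that] that by auto
    then have "v $ k = 0" if "k < n" for k using inv[OF that] that by simp
    then have "v = 0\<^sub>v n" using v(1) by (intro eq_vecI) auto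
    then show False using v(2) by simp
  qed
qed

text \<open>The Hermitian form of \<open>A\<close> takes a real value \<open>q\<close> at the
  character; since all entries of the character have modulus 1, this value is
  \<open>n * \<mu>\<close>.\<close>

lemma hermitian_fourier_diagonal_real:
  fixes A :: "complex mat"
  assumes n: "n \<ge> 1" and A: "A \<in> carrier_mat n n" and H: "hermitian_mat A"
    and ev: "\<And>j. j < n \<Longrightarrow> (\<Sum>k<n. A $$ (j, k) * zeta n ^ (r * k)) = \<mu> * zeta n ^ (r * j)"
  shows "cnj \<mu> = \<mu>"
proof -
  define q where "q = (\<Sum>j<n. \<Sum>k<n. cnj (zeta n ^ (r * j)) * A $$ (j, k) * zeta n ^ (r * k))"
  have "q = (\<Sum>j<n. cnj (zeta n ^ (r * j)) * (\<mu> * zeta n ^ (r * j)))"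
    unfolding q_def by (intro sum.cong refl) (simp add: mult.assoc ev flip: sum_distrib_left)
  also have "\<dots> = (\<Sum>j<n. \<mu> * (zeta n ^ (r * j) * cnj (zeta n ^ (r * j))))"
    by (simp only: mult_ac)
  also have "\<dots> = of_nat n * \<mu>" unfolding zeta_power_mult_cnj by simp
  finally have q: "q = of_nat n * \<mu>" .
  have "cnj q = (\<Sum>j<n. \<Sum>k<n. cnj (zeta n ^ (r * k)) * A $$ (k, j) * zeta n ^ (r * j))"
    unfolding q_def cnj_sum
  proof (intro sum.cong refl)
    fix j k assume "j \<in> {..<n}" "k \<in> {..<n}"
    then have "A $$ (k, j) = cnj (A $$ (j, k))"
      using H hermitian_mat_iff[OF A] by blast
    then show "cnj (cnj (zeta n ^ (r * j)) * A $$ (j, k) * zeta n ^ (r * k)) =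
        cnj (zeta n ^ (r * k)) * A $$ (k, j) * zeta n ^ (r * j)"
      by (simp add: mult_ac)
  qed
  also have "\<dots> = q" unfolding q_def by (rule sum.swap)
  finally show ?thesis using q n by simp
qed

section \<open>Time averages of oscillating exponentials\<close>

lemma has_integral_exp_i:
  assumes "\<theta> \<noteq> 0" "T \<ge> 0"
  shows "((\<lambda>t::real. exp (\<i> * of_real (\<theta> * t))) has_integral
    ((exp (\<i> * of_real (\<theta> * T)) - 1) / (\<i> * of_real \<theta>))) {0..T}"
proof -
  have "((\<lambda>t::real. exp (\<i> * of_real (\<theta> * t)) / (\<i> * of_real \<theta>)) has_vector_derivative
      exp (\<i> * of_real (\<theta> * t))) (at t within {0..T})" for t
  proof -
    \<comment> \<open>The antiderivative is differentiated over the complex plane, then restricted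
      to the real line.\<close>
    have "((\<lambda>z. exp (\<i> * of_real \<theta> * z) / (\<i> * of_real \<theta>)) has_field_derivative
        exp (\<i> * of_real \<theta> * of_real t)) (at (of_real t))"
      using assms by (auto intro!: derivative_eq_intros)
    from has_vector_derivative_real_field[OF this] show ?thesis
      by (simp add: mult_ac has_vector_derivative_at_within)
  qed
  from fundamental_theorem_of_calculus[OF assms(2) this] show ?thesis
    by (simp add: diff_divide_distrib)
qed

text \<open>For nonzero frequency the integral is bounded by \<open>2 / \<bar>\<theta>\<bar>\<close>
  uniformly in \<open>T\<close>, so dividing by \<open>T\<close> sends it to 0. For zero frequency
  the integrand is 1.\<close>

lemma exp_i_time_average:
  fixes \<theta> :: real
  shows "((\<lambda>T::real. (1 / T) *\<^sub>R integral {0..T} (\<lambda>t. exp (\<i> * of_real (\<theta> * t))))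
    \<longlongrightarrow> (if \<theta> = 0 then 1 else 0)) at_top"
proof (cases "\<theta> = 0")
  case True
  \<comment> \<open>The average is 1 only for \<open>T > 0\<close>: at 0 the factor
    \<open>1 / T\<close> is 0, and for negative \<open>T\<close> the interval is empty.\<close>
  have "eventually (\<lambda>T::real. (1 / T) *\<^sub>R integral {0..T} (\<lambda>t. exp (\<i> * of_real (\<theta> * t))) = 1) at_top"
    using eventually_gt_at_top[of 0] by eventually_elim (simp add: True scaleR_conv_of_real)
  then show ?thesis using True by (simp add: tendsto_eventually)
next
  case False
  have "((\<lambda>T::real. (1 / T) *\<^sub>R integral {0..T} (\<lambda>t. exp (\<i> * of_real (\<theta> * t)))) \<longlongrightarrow> 0) at_top"
  proof (rule Lim_null_comparison)
    show "((\<lambda>T. (2 / \<bar>\<theta>\<bar>) * (1 / T)) \<longlongrightarrow> 0) at_top"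
      by (intro tendsto_mult_right_zero tendsto_divide_0[OF tendsto_const]
          filterlim_at_top_imp_at_infinity filterlim_ident)
    show "eventually (\<lambda>T. norm ((1 / T) *\<^sub>R integral {0..T} (\<lambda>t. exp (\<i> * of_real (\<theta> * t))))
        \<le> (2 / \<bar>\<theta>\<bar>) * (1 / T)) at_top"
      using eventually_gt_at_top[of 0]
    proof eventually_elim
      case (elim T)
      have "norm (exp (\<i> * of_real (\<theta> * T)) - 1) \<le> 2"
        using norm_triangle_ineq4[of "exp (\<i> * of_real (\<theta> * T))" 1]
        by (simp only: norm_exp_i_times norm_one)
      then have "norm (integral {0..T} (\<lambda>t. exp (\<i> * of_real (\<theta> * t)))) \<le> 2 / \<bar>\<theta>\<bar>"
        unfolding integral_unique[OF has_integral_exp_i[OF False less_imp_le[OF elim]]]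
        by (simp add: norm_divide norm_mult divide_right_mono)
      then have "norm (integral {0..T} (\<lambda>t. exp (\<i> * of_real (\<theta> * t)))) / T \<le> 2 / \<bar>\<theta>\<bar> / T"
        by (rule divide_right_mono) (use elim in simp)
      then show ?case using elim by simp
    qed
  qed
  then show ?thesis using False by simp
qed

lemma exp_i_sum_time_average:
  fixes \<theta> :: "'a \<Rightarrow> real" and c :: "'a \<Rightarrow> complex"
  assumes "finite S"
  shows "((\<lambda>T::real. (1 / T) *\<^sub>R integral {0..T} (\<lambda>t. \<Sum>p\<in>S. exp (\<i> * of_real (\<theta> p * t)) * c p))
    \<longlongrightarrow> (\<Sum>p\<in>S. if \<theta> p = 0 then c p else 0)) at_top"
proof -
  have int: "(\<lambda>t. exp (\<i> * of_real (\<theta> p * t)) * c p) integrable_on {0..T}" for p and T :: real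
    by (intro integrable_continuous_real continuous_intros)
  have eq: "(1 / T) *\<^sub>R integral {0..T} (\<lambda>t. \<Sum>p\<in>S. exp (\<i> * of_real (\<theta> p * t)) * c p) =
      (\<Sum>p\<in>S. (1 / T) *\<^sub>R integral {0..T} (\<lambda>t. exp (\<i> * of_real (\<theta> p * t))) * c p)" for T :: real
    using assms int by (simp add: integral_sum scaleR_sum_right)
  have "((\<lambda>T::real. \<Sum>p\<in>S. (1 / T) *\<^sub>R integral {0..T} (\<lambda>t. exp (\<i> * of_real (\<theta> p * t))) * c p)
      \<longlongrightarrow> (\<Sum>p\<in>S. (if \<theta> p = 0 then 1 else 0) * c p)) at_top"
    by (intro tendsto_sum tendsto_mult_right exp_i_time_average)
  moreover have "(\<Sum>p\<in>S. (if \<theta> p = 0 then 1 else 0) * c p) = (\<Sum>p\<in>S. if \<theta> p = 0 then c p else 0)"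
    by (intro sum.cong) auto
  ultimately show ?thesis unfolding eq by simp
qed

section \<open>The mixing matrix of a circulant and its average\<close>

text \<open>Multiplying the expansion of a transition entry by its conjugate gives a double sum. As
  the \<open>\<mu> r\<close> are real, conjugation only flips the sign of the phase, leaving
  frequencies \<open>\<mu> s - \<mu> r\<close>.\<close>

lemma fourier_diagonal_mixing_mat:
  fixes A :: "complex mat" and \<mu> :: "nat \<Rightarrow> real"
  assumes A: "A \<in> carrier_mat n n"
    and ev: "\<And>r j. j < n \<Longrightarrow>
      (\<Sum>k<n. A $$ (j, k) * zeta n ^ (r * k)) = of_real (\<mu> r) * zeta n ^ (r * j)"
    and jk: "j < n" "k < n"
  shows "mixing_mat A t $$ (j, k) =
    (\<Sum>(r, s)\<in>{..<n} \<times> {..<n}. exp (\<i> * of_real ((\<mu> s - \<mu> r) * t)) *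
      (zeta n ^ (r * j) * cnj (zeta n ^ (r * k)) *
       cnj (zeta n ^ (s * j) * cnj (zeta n ^ (s * k))) / (of_nat n)\<^sup>2))"
proof -
  let ?c = "\<lambda>r. zeta n ^ (r * j) * cnj (zeta n ^ (r * k))"
  let ?B = "(- \<i> * complex_of_real t) \<cdot>\<^sub>m A"
  have B: "?B \<in> carrier_mat n n" using A by simp
  have evB: "(\<Sum>k<n. ?B $$ (i, k) * zeta n ^ (r * k)) =
      (- \<i> * of_real t * of_real (\<mu> r)) * zeta n ^ (r * i)" if "i < n" for r i
  proof -
    have "(\<Sum>k<n. ?B $$ (i, k) * zeta n ^ (r * k)) =
        (\<Sum>k<n. (- \<i> * of_real t) * (A $$ (i, k) * zeta n ^ (r * k)))"
      using A that by (intro sum.cong refl) simp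
    also have "\<dots> = (- \<i> * of_real t) * (\<Sum>k<n. A $$ (i, k) * zeta n ^ (r * k))"
      by (rule sum_distrib_left[symmetric])
    finally show ?thesis by (simp only: ev[OF that] mult.assoc)
  qed
  define U where "U = transition_mat A t $$ (j, k)"
  have U: "U = (\<Sum>r<n. exp (- \<i> * of_real t * of_real (\<mu> r)) * ?c r) / of_nat n"
    unfolding U_def transition_mat_def by (rule fourier_diagonal_mat_exp[OF B evB jk])
  have "cnj U = (\<Sum>s<n. exp (\<i> * of_real t * of_real (\<mu> s)) * cnj (?c s)) / of_nat n"
    unfolding U by (simp add: exp_cnj)
  then have "U * cnj U = (\<Sum>r<n. \<Sum>s<n. exp (- \<i> * of_real t * of_real (\<mu> r)) * ?c r *
      (exp (\<i> * of_real t * of_real (\<mu> s)) * cnj (?c s))) / (of_nat n)\<^sup>2"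
    unfolding U by (simp only: times_divide_times_eq power2_eq_square sum_product)
  also have "\<dots> = (\<Sum>(r, s)\<in>{..<n} \<times> {..<n}. exp (- \<i> * of_real t * of_real (\<mu> r)) * ?c r *
      (exp (\<i> * of_real t * of_real (\<mu> s)) * cnj (?c s)) / (of_nat n)\<^sup>2)"
    unfolding sum.cartesian_product sum_divide_distrib by (simp only: case_prod_unfold)
  also have "\<dots> = (\<Sum>(r, s)\<in>{..<n} \<times> {..<n}. exp (\<i> * of_real ((\<mu> s - \<mu> r) * t)) *
      (?c r * cnj (?c s) / (of_nat n)\<^sup>2))"
  proof (intro sum.cong refl, clarify)
    fix r s
    have "exp (\<i> * of_real ((\<mu> s - \<mu> r) * t)) =
        exp (- \<i> * of_real t * of_real (\<mu> r)) * exp (\<i> * of_real t * of_real (\<mu> s))"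
      by (simp add: algebra_simps flip: exp_add)
    then show "exp (- \<i> * of_real t * of_real (\<mu> r)) * ?c r *
        (exp (\<i> * of_real t * of_real (\<mu> s)) * cnj (?c s)) / (of_nat n)\<^sup>2 =
        exp (\<i> * of_real ((\<mu> s - \<mu> r) * t)) * (?c r * cnj (?c s) / (of_nat n)\<^sup>2)"
      by (simp only: mult_ac times_divide_eq_right)
  qed
  finally have "U * cnj U = \<dots>" .
  moreover have "mixing_mat A t $$ (j, k) = U * cnj U"
    using A jk by (simp add: mixing_mat_def hadamard_prod_def U_def transition_mat_def mat_exp_def)
  ultimately show ?thesis by simp
qed

theorem theorem5:
  fixes n :: nat and A :: "complex mat"
  assumes "n \<ge> 1"
    and "A \<in> carrier_mat n n"
    and "hermitian_mat A"
    and "circulant_mat n A"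
    and "card (spectrum A) = n"
  shows "average_uniform_mixing A"
proof -
  note n = assms(1) and A = assms(2)
  define \<nu> where "\<nu> r = (\<Sum>d<n. A $$ (0, d) * zeta n ^ (r * d))" for r
  have ev: "(\<Sum>k<n. A $$ (j, k) * zeta n ^ (r * k)) = \<nu> r * zeta n ^ (r * j)" if "j < n" for r j
    unfolding \<nu>_def by (rule circulant_mat_eigen[OF n assms(4) that])
  define \<mu> where "\<mu> r = Re (\<nu> r)" for r
  have \<nu>: "\<nu> r = of_real (\<mu> r)" for r
    using hermitian_fourier_diagonal_real[OF n A assms(3) ev]
    by (simp add: \<mu>_def complex_eq_iff)
  \<comment> \<open>The \<open>n\<close> elements of the spectrum lie in an image of
    \<open>n\<close> indices, which forces \<open>\<nu>\<close> to be injective there.\<close>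
  have "card (\<nu> ` {..<n}) = card {..<n}"
    using card_mono[OF _ spectrum_fourier_diagonal[OF A ev]] card_image_le[of "{..<n}" \<nu>] assms(5)
    by simp
  then have "inj_on \<nu> {..<n}" by (intro eq_card_imp_inj_on) auto
  then have inj: "\<mu> r = \<mu> s \<longleftrightarrow> r = s" if "r < n" "s < n" for r s
    using that by (auto simp: inj_on_def \<nu>)
  have "((\<lambda>T::real. (1 / T) *\<^sub>R integral {0..T} (\<lambda>t. mixing_mat A t $$ (j, k)))
      \<longlongrightarrow> 1 / of_nat n) at_top" if jk: "j < n" "k < n" for j k
  proof -
    let ?S = "{..<n} \<times> {..<n}"
    let ?c = "\<lambda>r. zeta n ^ (r * j) * cnj (zeta n ^ (r * k))"
    let ?d = "\<lambda>p. ?c (fst p) * cnj (?c (snd p)) / (of_nat n)\<^sup>2"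
    let ?\<theta> = "\<lambda>p. \<mu> (snd p) - \<mu> (fst p)"
    have mix: "mixing_mat A t $$ (j, k) = (\<Sum>p\<in>?S. exp (\<i> * of_real (?\<theta> p * t)) * ?d p)" for t
      using fourier_diagonal_mixing_mat[OF A ev[unfolded \<nu>] jk]
      by (simp only: case_prod_unfold)
    have c: "?c r * cnj (?c r) = 1" for r
      by (simp add: complex_norm_square[symmetric] norm_mult norm_power del: complex_cnj_mult)
    \<comment> \<open>By injectivity the frequency vanishes only for \<open>r = s\<close>; these
      \<open>n\<close> terms are each \<open>1 / n^2\<close>.\<close>
    have "(\<Sum>p\<in>?S. if ?\<theta> p = 0 then ?d p else 0) =
        (\<Sum>r<n. \<Sum>s<n. if r = s then ?c r * cnj (?c r) / (of_nat n)\<^sup>2 else 0)"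
      unfolding sum.cartesian_product
      by (intro sum.cong refl) (auto simp: inj)
    also have "\<dots> = 1 / of_nat n"
      unfolding c using n by (simp add: power2_eq_square)
    finally show ?thesis
      using exp_i_sum_time_average[of ?S ?\<theta> ?d] unfolding mix by simp
  qed
  then show ?thesis
    using A by (simp add: average_uniform_mixing_def has_average_mixing_mat_def all_ones_mat_def)
qed

end
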